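(* For all positive integers $m,n,h,k,t$ with $m\geq k\geq 1$, $n\geq h\geq 1$, $nk=mh$ and $t\mid 2nk$, there exists a relative non-zero sum Heffter array $\mathrm{NH}_t(m,n;h,k)$.
   Context: A partially filled (p.f.) array on a set $\Omega$ is a matrix whose cells are either empty or contain an element of $\Omega$. Let $t\ge 1$ be a divisor of $2nk$, put $v=2nk+t$ and let $J$ be the subgroup of $\mathbb{Z}_v$ of order $t$. A (relative) non-zero sum Heffter array $\mathrm{NH}_t(m,n;h,k)$ is an $m\times n$ p.f. array $A$ with elements in $\mathbb{Z}_v$ such that: (a) each row contains exactly $h$ filled cells and each column contains exactly $k$ filled cells; (b) the multiset $\{\pm x\mid x\in A\}$ (two elements $x,-x$ for each filled cell with entry $x$) contains each element of $\mathbb{Z}_v\setminus J$ exactly once and no element of $J$; (c) the sum of the elements in every row and in every column is different from $0$ in $\mathbb{Z}_v$. *)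

theory Defs
  imports
    "HOL-Library.Multiset"
    "HOL-Number_Theory.Residues"
    "Jordan_Normal_Form.Matrix"
begin

type_synonym 'a pf_array = "'a option mat"

definition filled_cells :: "'a pf_array \<Rightarrow> (nat \<times> nat) set" where
  "filled_cells A =
    {(i, j). i < dim_row A \<and> j < dim_col A \<and> A $$ (i, j) \<noteq> None}"

definition row_cells :: "'a pf_array \<Rightarrow> nat \<Rightarrow> (nat \<times> nat) set" where
  "row_cells A i = {c \<in> filled_cells A. fst c = i}"

definition col_cells :: "'a pf_array \<Rightarrow> nat \<Rightarrow> (nat \<times> nat) set" where
  "col_cells A j = {c \<in> filled_cells A. snd c = j}"

definition entry :: "'a pf_array \<Rightarrow> nat \<times> nat \<Rightarrow> 'a" where
  "entry A c = the (A $$ c)"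

definition pm_entries :: "('a, 'b) ring_scheme \<Rightarrow> 'a pf_array \<Rightarrow> 'a multiset" where
  "pm_entries R A =
    (\<Sum>c\<in>filled_cells A. {# entry A c, \<ominus>\<^bsub>R\<^esub> entry A c #})"

text \<open>
  The group \<open>\<int>\<^sub>v\<close> is the additive group of \<open>residue_ring v\<close>, whose carrier is
  \<open>{0..v - 1}\<close>. Since it is cyclic, it has at most one subgroup of order \<open>t\<close>, and exactly one
  when \<open>t\<close> divides \<open>v\<close>; so the existentially quantified \<open>J\<close> below is the subgroup of order \<open>t\<close>.
  The standing assumptions that \<open>t\<close> is positive and divides \<open>2 * n * k\<close> are not part of the
  predicate.
\<close>

definition is_nonzero_sum_Heffter_array ::
    "nat \<Rightarrow> nat \<Rightarrow> nat \<Rightarrow> nat \<Rightarrow> nat \<Rightarrow> int pf_array \<Rightarrow> bool" where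
  "is_nonzero_sum_Heffter_array t m n h k A \<longleftrightarrow>
    (let R = residue_ring (int (2 * n * k + t)) in
      A \<in> carrier_mat m n \<and>
      (\<forall>c\<in>filled_cells A. entry A c \<in> carrier R) \<and>
      (\<forall>i<m. card (row_cells A i) = h) \<and>
      (\<forall>j<n. card (col_cells A j) = k) \<and>
      (\<exists>J. subgroup J (add_monoid R) \<and> card J = t \<and>
         (\<forall>x\<in>carrier R - J. count (pm_entries R A) x = 1) \<and>
         (\<forall>x\<in>J. count (pm_entries R A) x = 0)) \<and>
      (\<forall>i<m. finsum R (entry A) (row_cells A i) \<noteq> \<zero>\<^bsub>R\<^esub>) \<and>
      (\<forall>j<n. finsum R (entry A) (col_cells A j) \<noteq> \<zero>\<^bsub>R\<^esub>))"

end

theory Submission imports Defs begin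

text \<open>
  List the elements of \<open>\<int>\<^sub>v - J\<close> below \<open>v / 2\<close> as \<open>x\<^sub>0 < x\<^sub>1 < \<dots>\<close> and use \<open>(- 1)\<^sup>e x\<^sub>e\<close> as the entries.
  If the indices \<open>e\<close> occurring in a line alternate in parity when listed increasingly, the sum of
  that line is an alternating sum of an increasing sequence of positive integers, hence nonzero and
  smaller than \<open>v / 2\<close> in absolute value. Filling the rows with consecutive blocks of \<open>h\<close> indices makes
  all rows alternate. If \<open>n\<close> is odd, the columns can be taken to be the residue classes modulo \<open>n\<close>; if
  \<open>n\<close> is even, the columns are shifted cyclically by one after every \<open>n\<close> indices.
\<close>

section \<open>Alternating sums of increasing sequences\<close>

text \<open>The factor \<open>(- 1) ^ l\<close> makes the last term count positively. With this
  sign, passing to \<open>Suc l\<close> replaces the sum \<open>T\<close> by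
  \<open>y (Suc l) - T\<close>, and 0 < \<open>T\<close> \<le> \<open>y l\<close> <
  \<open>y (Suc l)\<close> keeps both bounds alive; hence they are proved together.\<close>

lemma alternating_sum_bounds:
  fixes y :: "nat \<Rightarrow> int"
  assumes "y 0 > 0" and "\<And>i. i < l \<Longrightarrow> y i < y (Suc i)"
  shows "0 < (- 1) ^ l * (\<Sum>i\<le>l. (- 1) ^ i * y i)"
    and "(- 1) ^ l * (\<Sum>i\<le>l. (- 1) ^ i * y i) \<le> y l"
proof -
  have "0 < (- 1) ^ l * (\<Sum>i\<le>l. (- 1) ^ i * y i) \<and> (- 1) ^ l * (\<Sum>i\<le>l. (- 1) ^ i * y i) \<le> y l"
    using assms
  proof (induction l)
    case (Suc l)
    have "(- 1) ^ Suc l * (\<Sum>i\<le>Suc l. (- 1) ^ i * y i)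
        = y (Suc l) - (- 1) ^ l * (\<Sum>i\<le>l. (- 1) ^ i * y i)"
      by (simp add: algebra_simps flip: power_add mult_2)
    moreover have "0 < (- 1) ^ l * (\<Sum>i\<le>l. (- 1) ^ i * y i)"
      and "(- 1) ^ l * (\<Sum>i\<le>l. (- 1) ^ i * y i) \<le> y l"
      using Suc.IH Suc.prems by simp_all
    ultimately show ?case
      using Suc.prems(2)[of l] by linarith
  qed simp
  then show "0 < (- 1) ^ l * (\<Sum>i\<le>l. (- 1) ^ i * y i)"
    and "(- 1) ^ l * (\<Sum>i\<le>l. (- 1) ^ i * y i) \<le> y l"
    by auto
qed

text \<open>Parity is measured relative to \<open>f 0\<close>, so a line may start with either
  sign.\<close>

definition alternating_enum :: "(nat \<Rightarrow> nat) \<Rightarrow> nat \<Rightarrow> nat set \<Rightarrow> bool" where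
  "alternating_enum f l S \<longleftrightarrow>
    strict_mono_on {..<l} f \<and> f ` {..<l} = S \<and> (\<forall>p<l. even (f p) \<longleftrightarrow> even (f 0 + p))"

lemma alternating_enum_card:
  assumes "alternating_enum f l S"
  shows "card S = l"
  using assms strict_mono_on_imp_inj_on card_image unfolding alternating_enum_def
  by (metis card_lessThan)

text \<open>By the parity condition the sign \<open>(- 1) ^ f 0\<close> factors out, leaving an
  alternating sum of the increasing positive integers \<open>x (f p)\<close>. Its absolute value is
  positive and at most the largest term, which is below \<open>v\<close>.\<close>

lemma alternating_enum_sum_not_dvd:
  fixes x :: "nat \<Rightarrow> int"
  assumes f: "alternating_enum f l S" and "l > 0" and "S \<subseteq> {..<N}"
    and mono: "strict_mono_on {..<N} x"
    and pos: "\<And>e. e < N \<Longrightarrow> 0 < x e" and less: "\<And>e. e < N \<Longrightarrow> 2 * x e < v"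
  shows "\<not> v dvd (\<Sum>e\<in>S. (- 1) ^ e * x e)"
proof -
  obtain l' where l: "l = Suc l'"
    using \<open>l > 0\<close> by (cases l) auto
  have f_mono: "strict_mono_on {..<l} f" and S: "S = f ` {..<l}"
    and parity: "\<And>p. p < l \<Longrightarrow> even (f p) \<longleftrightarrow> even (f 0 + p)"
    using f unfolding alternating_enum_def by blast+
  have fN: "f p < N" if "p < l" for p
    using that S \<open>S \<subseteq> {..<N}\<close> by auto
  define T where "T = (\<Sum>p\<le>l'. (- 1) ^ p * x (f p))"
  have "(\<Sum>e\<in>S. (- 1) ^ e * x e) = (\<Sum>p\<le>l'. (- 1) ^ f p * x (f p))"
    unfolding S l lessThan_Suc_atMost[symmetric]
    using strict_mono_on_imp_inj_on[OF f_mono] l by (simp add: sum.reindex)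
  also have "\<dots> = (\<Sum>p\<le>l'. (- 1) ^ f 0 * ((- 1) ^ p * x (f p)))"
  proof (rule sum.cong)
    fix p assume "p \<in> {..l'}"
    with parity[of p] l have "(- 1 :: int) ^ f p = (- 1) ^ (f 0 + p)"
      by (auto simp: minus_one_power_iff)
    then show "(- 1) ^ f p * x (f p) = (- 1) ^ f 0 * ((- 1) ^ p * x (f p))"
      by (simp add: power_add)
  qed simp
  finally have sum: "(\<Sum>e\<in>S. (- 1) ^ e * x e) = (- 1) ^ f 0 * T"
    by (simp add: T_def sum_distrib_left)
  have step: "x (f i) < x (f (Suc i))" if "i < l'" for i
    using that l fN[of i] fN[of "Suc i"] f_mono mono by (auto simp: strict_mono_on_def)
  have "0 < x (f 0)"
    using pos fN l by simp
  note bounds = alternating_sum_bounds[of "\<lambda>p. x (f p)" l', OF this step, folded T_def]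
  have "x (f l') < v"
    using less[OF fN[of l']] pos[OF fN[of l']] l by simp
  with bounds have "0 < \<bar>T\<bar>" "\<bar>T\<bar> < v"
    by (auto simp: minus_one_power_iff split: if_splits)
  moreover have "\<bar>(- 1) ^ f 0 * T\<bar> = \<bar>T\<bar>"
    by (simp add: abs_mult power_abs)
  ultimately show ?thesis
    unfolding sum using zdvd_imp_le[of v "\<bar>T\<bar>"] by (metis dvd_abs_iff not_le)
qed

section \<open>Placement of the indices in rows and columns\<close>

lemma alternating_skeleton:
  fixes m n h k :: nat
  assumes "n > 0" and "h > 0" and "h \<le> n" and nk: "n * k = m * h"
  obtains r c where
    "inj_on (\<lambda>e. (r e, c e)) {..<n * k}"
    "\<And>e. e < n * k \<Longrightarrow> r e < m" "\<And>e. e < n * k \<Longrightarrow> c e < n"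
    "\<And>i. i < m \<Longrightarrow> \<exists>f. alternating_enum f h {e. e < n * k \<and> r e = i}"
    "\<And>j. j < n \<Longrightarrow> \<exists>f. alternating_enum f k {e. e < n * k \<and> c e = j}"
proof
  \<comment> \<open>\<open>s\<close> is the column shift per block of \<open>n\<close> indices. For
    odd \<open>n\<close>, steps of length \<open>n\<close> already change parity; for even
    \<open>n\<close>, the shift by one has to do it.\<close>
  define s :: nat where "s = (if even n then 1 else 0)"
  define c where "c e = (e mod n + s * (e div n)) mod n" for e
  show "e div h < m" if "e < n * k" for e
    using that by (simp add: nk less_mult_imp_div_less)
  show "c e < n" for e
    using \<open>n > 0\<close> by (simp add: c_def)
  have no_clash: False
    if row: "e div h = e' div h" and col: "c e = c e'" and "e < e'" for e e'
  proof -
    define p a p' a' where "p = e div n" and "a = e mod n" and "p' = e' div n" and "a' = e' mod n"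
    have e: "e = p * n + a" "a < n" and e': "e' = p' * n + a'" "a' < n"
      using \<open>n > 0\<close> by (simp_all add: p_def a_def p'_def a'_def)
    have "e' - e < h"
      using row \<open>e < e'\<close> \<open>h > 0\<close> div_mult_mod_eq[of e h] div_mult_mod_eq[of e' h, folded row]
        mod_less_divisor[of h e'] by linarith
    have cong: "[a + s * p = a' + s * p'] (mod n)"
      using col by (simp add: c_def cong_def p_def a_def p'_def a'_def)
    have "p \<le> p'"
      using \<open>e < e'\<close> by (simp add: p_def p'_def div_le_mono)
    \<comment> \<open>Within one block the shift is constant, so columns are distinct; two blocks or
      more apart, the indices differ by more than \<open>n\<close>, but a common row allows only
      less than \<open>h\<close>. The adjacent blocks are the delicate case.\<close>
    then consider "p' = p" | "p' = Suc p" | "p' \<ge> p + 2"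
      by linarith
    then show False
    proof cases
      case 1
      then have "a = a'"
        using cong e e' by (simp add: cong_add_rcancel_nat cong_less_modulus_unique_nat)
      then show ?thesis using 1 e e' \<open>e < e'\<close> by simp
    next
      case 2
      \<comment> \<open>Here \<open>e' - e\<close> equals \<open>n + a' - a\<close>, which is less
        than \<open>h\<close> and so less than \<open>n\<close>. For odd \<open>n\<close> the
        congruence then fails; for even \<open>n\<close> it forces a difference of
        \<open>n - 1\<close>. This leaves only \<open>h = n\<close>, where rows coincide with blocks
        and cannot meet two of them.\<close>
      have "a' < a"
        using \<open>e' - e < h\<close> \<open>h \<le> n\<close> \<open>e < e'\<close> e e' 2 by simp
      have "[a + s * p = (a' + s) + s * p] (mod n)"
        using cong 2 by (simp add: algebra_simps)
      then have "[a = a' + s] (mod n)"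
        by (simp add: cong_add_rcancel_nat)
      moreover have "a' + s < n"
        using \<open>a' < a\<close> e by (simp add: s_def)
      ultimately have "a = a' + s"
        using e by (simp add: cong_less_modulus_unique_nat)
      with \<open>a' < a\<close> have "a = Suc a'"
        by (simp add: s_def split: if_splits)
      then have "h = n"
        using \<open>e' - e < h\<close> \<open>h \<le> n\<close> \<open>e < e'\<close> e e' 2 by simp
      then show ?thesis using row 2 by (simp add: p_def p'_def)
    next
      case 3
      then have "(p + 2) * n \<le> p' * n" by (rule mult_le_mono1)
      then show ?thesis
        using \<open>e' - e < h\<close> \<open>h \<le> n\<close> \<open>e < e'\<close> e e' by (simp add: algebra_simps)
    qed
  qed
  show "inj_on (\<lambda>e. (e div h, c e)) {..<n * k}"
    by (rule inj_onI) (metis no_clash Pair_inject linorder_neqE_nat)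
  show "\<exists>f. alternating_enum f h {e. e < n * k \<and> e div h = i}" if "i < m" for i
  proof (intro exI)
    have "e \<in> (\<lambda>p. i * h + p) ` {..<h}" if "e div h = i" for e
      using that \<open>h > 0\<close> by (intro image_eqI[of _ _ "e mod h"]) auto
    moreover have "i * h + p < n * k" if "p < h" for p
    proof -
      have "i * h + p < Suc i * h" using that by simp
      also have "\<dots> \<le> m * h" using \<open>i < m\<close> by (intro mult_le_mono1) simp
      finally show ?thesis by (simp add: nk)
    qed
    ultimately have "(\<lambda>p. i * h + p) ` {..<h} = {e. e < n * k \<and> e div h = i}"
      by auto
    then show "alternating_enum (\<lambda>p. i * h + p) h {e. e < n * k \<and> e div h = i}"
      by (simp add: alternating_enum_def strict_mono_on_def)
  qed
  show "\<exists>f. alternating_enum f k {e. e < n * k \<and> c e = j}" if "j < n" for j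
  proof (intro exI)
    \<comment> \<open>The only index of block \<open>p\<close> in column \<open>j\<close> has
      remainder \<open>j - s * p\<close> modulo \<open>n\<close>; the factor \<open>n - 1\<close>
      plays the role of -1 in the natural numbers.\<close>
    define f where "f p = p * n + (j + (n - 1) * s * p) mod n" for p
    have f_div: "f p div n = p" and f_mod: "f p mod n = (j + (n - 1) * s * p) mod n" for p
      using \<open>n > 0\<close> by (simp_all add: f_def)
    have shift: "(n - 1) * s * p + s * p = n * (s * p)" for p
      using \<open>n > 0\<close> by (cases n) (simp_all add: algebra_simps)
    have c_f: "c (f p) = j" for p
    proof -
      have "c (f p) = (j + ((n - 1) * s * p + s * p)) mod n"
        by (simp add: c_def f_div f_mod mod_add_left_eq add.assoc)
      then show ?thesis using \<open>j < n\<close> unfolding shift by simp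
    qed
    have f_less: "f p < n * k" if "p < k" for p
    proof -
      have "f p < Suc p * n" using \<open>n > 0\<close> by (simp add: f_def)
      also have "\<dots> \<le> k * n" using that by (intro mult_le_mono1) simp
      finally show ?thesis by (simp add: mult.commute)
    qed
    have e_f: "e = f (e div n)" if "c e = j" for e
    proof -
      have "(j + (n - 1) * s * (e div n)) mod n
          = (e mod n + ((n - 1) * s * (e div n) + s * (e div n))) mod n"
        by (simp add: that[symmetric] c_def mod_add_left_eq ac_simps)
      then show ?thesis unfolding shift by (simp add: f_def)
    qed
    have "f ` {..<k} = {e. e < n * k \<and> c e = j}"
    proof (intro equalityI subsetI)
      fix e assume "e \<in> {e. e < n * k \<and> c e = j}"
      then have "e = f (e div n)" "e div n < k"
        using e_f by (auto simp: less_mult_imp_div_less mult.commute)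
      then show "e \<in> f ` {..<k}" by blast
    qed (use c_f f_less in auto)
    moreover have "f p < f q" if "p < q" for p q
    proof -
      have "f p < Suc p * n" using \<open>n > 0\<close> by (simp add: f_def)
      also have "\<dots> \<le> q * n" using that by (intro mult_le_mono1) simp
      also have "\<dots> \<le> f q" by (simp add: f_def)
      finally show ?thesis .
    qed
    \<comment> \<open>For even \<open>n\<close>, reduction modulo \<open>n\<close> preserves parity
      and \<open>n - 1\<close> is odd, so the remainder contributes \<open>j + p\<close>. For odd
      \<open>n\<close> the remainder is \<open>j\<close> and \<open>p * n\<close> contributes
      \<open>p\<close>. The case \<open>p = 0\<close> gives \<open>f 0\<close> the parity of
      \<open>j\<close>.\<close>
    moreover have "even (f p) \<longleftrightarrow> even (j + p)" for p
    proof (cases "even n")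
      case True
      then have "even (f p) \<longleftrightarrow> even (j + (n - 1) * s * p)"
        by (simp add: f_def dvd_mod_iff)
      then show ?thesis using True \<open>n > 0\<close> by (simp add: s_def)
    next
      case False
      then show ?thesis using \<open>j < n\<close> by (auto simp: f_def s_def)
    qed
    ultimately show "alternating_enum f k {e. e < n * k \<and> c e = j}"
      by (simp add: alternating_enum_def strict_mono_on_def)
  qed
qed

lemma pf_array_from_enumeration:
  fixes cell :: "nat \<Rightarrow> nat \<times> nat" and a :: "nat \<Rightarrow> 'a"
  assumes inj: "inj_on cell I" and sub: "cell ` I \<subseteq> {..<m} \<times> {..<n}"
  obtains A where "A \<in> carrier_mat m n" "filled_cells A = cell ` I"
    "\<And>e. e \<in> I \<Longrightarrow> entry A (cell e) = a e"
proof
  \<comment> \<open>The inverse of the injective \<open>cell\<close> recovers the index placed in a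
    filled cell.\<close>
  define A where
    "A = mat m n (\<lambda>c. if c \<in> cell ` I then Some (a (the_inv_into I cell c)) else None)"
  have A: "A $$ (cell e) = Some (a e)" if "e \<in> I" for e
  proof -
    obtain i j where ij: "cell e = (i, j)" by force
    have "(i, j) \<in> cell ` I" using that ij by (metis imageI)
    with sub have "i < m" "j < n" by auto
    then show ?thesis
      using \<open>(i, j) \<in> cell ` I\<close> the_inv_into_f_f[OF inj that] by (simp add: A_def ij)
  qed
  show "A \<in> carrier_mat m n" by (simp add: A_def)
  show "filled_cells A = cell ` I"
  proof (intro equalityI subsetI)
    fix z assume "z \<in> cell ` I"
    then obtain e where "e \<in> I" "z = cell e" by blast
    moreover obtain i j where "z = (i, j)" by force
    ultimately show "z \<in> filled_cells A"
      using sub A[of e] by (auto simp: filled_cells_def A_def)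
  qed (auto simp: filled_cells_def A_def split: if_splits)
  show "entry A (cell e) = a e" if "e \<in> I" for e
    using A[OF that] by (simp add: entry_def)
qed

section \<open>The subgroup of order \<open>t\<close> and half of its complement\<close>

text \<open>Describing \<open>J\<close> as the multiples of \<open>w\<close> turns membership into
  divisibility, which survives reduction modulo \<open>v\<close> because \<open>w\<close> divides
  \<open>v\<close>. Its elements are \<open>w * i\<close> for \<open>i < t\<close>.\<close>

lemma residue_ring_multiples:
  fixes w t v :: nat
  assumes v: "v = w * t" and "v > 1"
  defines "J \<equiv> {a \<in> {0..<int v}. int w dvd a}"
  shows "subgroup J (add_monoid (residue_ring (int v)))" and "card J = t"
proof -
  interpret residues "int v" "residue_ring (int v)"
    using \<open>v > 1\<close> by unfold_locales simp_all
  have "w > 0" using v \<open>v > 1\<close> by (cases w) auto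
  have w_dvd: "int w dvd int v" by (simp add: v)
  show "subgroup J (add_monoid (residue_ring (int v)))"
  proof (rule add.subgroupI)
    show "J \<subseteq> carrier (residue_ring (int v))"
      by (auto simp: J_def res_carrier_eq)
    show "J \<noteq> {}"
      using \<open>v > 1\<close> by (auto simp: J_def intro!: exI[of _ 0])
    show "\<ominus>\<^bsub>residue_ring (int v)\<^esub> a \<in> J" if "a \<in> J" for a
      using that \<open>v > 1\<close> w_dvd by (auto simp: J_def res_neg_eq dvd_mod_iff)
    show "a \<oplus>\<^bsub>residue_ring (int v)\<^esub> b \<in> J" if "a \<in> J" "b \<in> J" for a b
      using that \<open>v > 1\<close> w_dvd by (auto simp: J_def res_add_eq dvd_mod_iff)
  qed
  have "J = (\<lambda>i. int w * int i) ` {..<t}"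
  proof (intro equalityI subsetI)
    fix a assume "a \<in> J"
    then obtain q where q: "a = int w * q" "0 \<le> a" "a < int w * int t"
      by (auto simp: J_def v)
    then have "0 \<le> q" "q < int t"
      using \<open>w > 0\<close> by (simp_all add: zero_le_mult_iff)
    then show "a \<in> (\<lambda>i. int w * int i) ` {..<t}"
      using q by (intro image_eqI[of _ _ "nat q"]) auto
  next
    fix a assume "a \<in> (\<lambda>i. int w * int i) ` {..<t}"
    then show "a \<in> J"
      using \<open>w > 0\<close> by (auto simp: J_def v)
  qed
  moreover have "inj_on (\<lambda>i. int w * int i) {..<t}"
    using \<open>w > 0\<close> by (auto simp: inj_on_def)
  ultimately show "card J = t"
    by (simp add: card_image)
qed

text \<open>The complement of \<open>J\<close> is closed under negation and has no self-inverse
  element, so it splits into pairs \<open>a\<close>, \<open>v - a\<close> with exactly one member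
  below \<open>v / 2\<close>. There are \<open>(v - t) / 2 = N\<close> pairs.\<close>

lemma half_set_enumeration:
  fixes N w t v :: nat
  assumes v: "v = w * t" "v = 2 * N + t" and "v > 1"
  defines "J \<equiv> {a \<in> {0..<int v}. int w dvd a}"
  obtains x :: "nat \<Rightarrow> int" where
    "strict_mono_on {..<N} x" "\<And>e. e < N \<Longrightarrow> 0 < x e" "\<And>e. e < N \<Longrightarrow> 2 * x e < int v"
    "(\<Sum>e<N. {#x e, int v - x e#}) = mset_set ({0..<int v} - J)"
proof -
  define X where "X = {a::nat. 2 * a < v \<and> \<not> w dvd a}"
  define U where "U = int ` X"
  define V where "V = (\<lambda>a. int v - a) ` U"
  have "finite X"
    by (rule finite_subset[of _ "{..<v}"]) (auto simp: X_def)
  then have fin: "finite U" "finite V" by (simp_all add: U_def V_def)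
  have X_pos: "0 < a" if "a \<in> X" for a
    using that by (cases a) (auto simp: X_def)
  \<comment> \<open>The midpoint \<open>v / 2\<close> would be its own negative. If it is an
    integer, then \<open>t\<close> is even as well, and the midpoint is \<open>w * (t / 2)\<close>,
    an element of \<open>J\<close>.\<close>
  have half: "int w dvd a" if "2 * a = int v" for a
  proof -
    have "even t" using that v(2) by presburger
    then obtain u where "t = 2 * u" by blast
    then have "a = int w * int u" using that v(1) by simp
    then show ?thesis by simp
  qed
  have w_dvd: "int w dvd int v" by (simp add: v(1))
  have disjoint: "U \<inter> V = {}"
    by (auto simp: U_def V_def X_def)
  have compl: "{0..<int v} - J = U \<union> V"
  proof (intro equalityI subsetI)
    fix a assume a: "a \<in> {0..<int v} - J"
    then have "\<not> int w dvd a" "\<not> int w dvd int v - a"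
      using w_dvd by (auto simp: J_def dvd_diff_right_iff)
    have "2 * a \<noteq> int v" using half \<open>\<not> int w dvd a\<close> by blast
    then have "2 * a < int v \<or> 2 * (int v - a) < int v" by presburger
    then consider "2 * a < int v" | "2 * (int v - a) < int v" by blast
    then show "a \<in> U \<union> V"
    proof cases
      case 1
      moreover obtain b where "a = int b" using a by (auto elim: nonneg_int_cases)
      ultimately have "a \<in> U" using \<open>\<not> int w dvd a\<close> by (simp add: U_def X_def)
      then show ?thesis ..
    next
      case 2
      moreover obtain b where "int v - a = int b"
        using a by (auto intro: zero_le_imp_eq_int[of "int v - a", THEN exE])
      ultimately have "int v - a \<in> U"
        using \<open>\<not> int w dvd int v - a\<close> by (simp add: U_def X_def)
      then have "a \<in> V" unfolding V_def by (intro image_eqI[of _ _ "int v - a"]) auto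
      then show ?thesis ..
    qed
  next
    fix a assume "a \<in> U \<union> V"
    then obtain b where b: "b \<in> X" and "a = int b \<or> a = int v - int b"
      by (auto simp: U_def V_def)
    moreover have "0 < b" using X_pos[OF b] .
    moreover have "\<not> int w dvd int b" using b by (simp add: X_def)
    moreover have "\<not> int w dvd int v - int b"
      using w_dvd \<open>\<not> int w dvd int b\<close> by (simp add: dvd_diff_right_iff)
    ultimately show "a \<in> {0..<int v} - J"
      by (auto simp: J_def X_def)
  qed
  have "card V = card X" "card U = card X"
    by (simp_all add: V_def U_def card_image inj_on_def)
  then have "card ({0..<int v} - J) = 2 * card X"
    by (simp add: compl card_Un_disjoint fin disjoint)
  moreover have "card ({0..<int v} - J) = v - t"
  proof -
    have "card ({0..<int v} - J) = card {0..<int v} - card J"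
      by (rule card_Diff_subset) (auto simp: J_def intro: finite_subset[of _ "{0..<int v}"])
    then show ?thesis
      using residue_ring_multiples(2)[OF v(1) \<open>v > 1\<close>] by (simp add: J_def)
  qed
  ultimately have N: "card X = N" using v(2) by simp
  \<comment> \<open>As \<open>X\<close> is finite, only the values at \<open>e < N\<close>, the
    cardinality of \<open>X\<close>, are meaningful.\<close>
  define x where "x e = int (enumerate X e)" for e
  have mono: "strict_mono_on {..<N} x"
    using \<open>finite X\<close> N by (auto simp: strict_mono_on_def x_def)
  have in_X: "enumerate X e \<in> X" if "e < N" for e
    using finite_enumerate_in_set[OF \<open>finite X\<close>] that N by simp
  have x_image: "x ` {..<N} = U"
    using in_X finite_enumerate_Ex[OF \<open>finite X\<close>] N by (force simp: U_def x_def)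
  have inj: "inj_on x {..<N}"
    using mono by (rule strict_mono_on_imp_inj_on)
  have inj': "inj_on (\<lambda>e. int v - x e) {..<N}"
    using inj by (simp add: inj_on_def)
  have "(\<Sum>e<N. {#x e, int v - x e#}) = (\<Sum>e<N. {#x e#} + {#int v - x e#})"
    by (simp add: add_mset_commute)
  also have "\<dots> = image_mset x (mset_set {..<N}) + image_mset (\<lambda>e. int v - x e) (mset_set {..<N})"
    unfolding sum.distrib by (simp add: sum_unfold_sum_mset)
  also have "\<dots> = mset_set U + mset_set V"
    unfolding V_def x_image[symmetric] image_image
    by (simp add: image_mset_mset_set inj inj')
  also have "\<dots> = mset_set ({0..<int v} - J)"
    unfolding compl by (rule mset_set_Union[symmetric]) (use fin disjoint in auto)
  finally have pm: "(\<Sum>e<N. {#x e, int v - x e#}) = mset_set ({0..<int v} - J)" .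
  show thesis
  proof (rule that[OF mono _ _ pm])
    show "0 < x e" if "e < N" for e
      using X_pos[OF in_X[OF that]] by (simp add: x_def)
    show "2 * x e < int v" if "e < N" for e
      using in_X[OF that] by (simp add: X_def x_def)
  qed
qed

section \<open>Assembly of the array\<close>

theorem theorem4p2:
  fixes m n h k t :: nat
  assumes "m > 0" and "n > 0" and "h > 0" and "k > 0" and "t > 0"
    and "m \<ge> k" and "k \<ge> 1" and "n \<ge> h" and "h \<ge> 1"
    and "n * k = m * h"
    and "t dvd 2 * n * k"
  shows "\<exists>A. is_nonzero_sum_Heffter_array t m n h k A"
proof -
  define N where "N = n * k"
  define v where "v = 2 * n * k + t"
  define R where "R = residue_ring (int v)"
  have "N > 0" using assms by (simp add: N_def)
  have vN: "v = 2 * N + t" by (simp add: v_def N_def)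
  then have "v > 1" using \<open>N > 0\<close> by simp
  interpret residues "int v" R
    using \<open>v > 1\<close> by unfold_locales (simp_all add: R_def)
  obtain w where w: "v = w * t"
  proof -
    have "t dvd v" using assms by (simp add: v_def)
    then show thesis using that by (metis dvd_def mult.commute)
  qed
  define J where "J = {a \<in> {0..<int v}. int w dvd a}"
  have J: "subgroup J (add_monoid R)" "card J = t"
    using residue_ring_multiples[OF w \<open>v > 1\<close>] by (simp_all add: J_def R_def)
  obtain x :: "nat \<Rightarrow> int" where mono: "strict_mono_on {..<N} x"
    and pos: "\<And>e. e < N \<Longrightarrow> 0 < x e" and less: "\<And>e. e < N \<Longrightarrow> 2 * x e < int v"
    and pm: "(\<Sum>e<N. {#x e, int v - x e#}) = mset_set ({0..<int v} - J)"
    using half_set_enumeration[OF w vN \<open>v > 1\<close>] unfolding J_def by blast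
  obtain r c where inj: "inj_on (\<lambda>e. (r e, c e)) {..<N}"
    and r: "\<And>e. e < N \<Longrightarrow> r e < m" and c: "\<And>e. e < N \<Longrightarrow> c e < n"
    and rows: "\<And>i. i < m \<Longrightarrow> \<exists>f. alternating_enum f h {e. e < N \<and> r e = i}"
    and cols: "\<And>j. j < n \<Longrightarrow> \<exists>f. alternating_enum f k {e. e < N \<and> c e = j}"
    using alternating_skeleton[OF \<open>n > 0\<close> \<open>h > 0\<close> \<open>n \<ge> h\<close> \<open>n * k = m * h\<close>] unfolding N_def by blast
  define cell where "cell e = (r e, c e)" for e
  \<comment> \<open>The signs control the line sums and leave the multiset of entries and their
    negatives unchanged.\<close>
  define a where "a e = ((- 1) ^ e * x e) mod int v" for e
  have inj_cell: "inj_on cell {..<N}" using inj by (simp add: cell_def[abs_def])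
  obtain A where A: "A \<in> carrier_mat m n" and filled: "filled_cells A = cell ` {..<N}"
    and entry: "\<And>e. e \<in> {..<N} \<Longrightarrow> entry A (cell e) = a e"
    by (rule pf_array_from_enumeration[OF inj_cell, of m n a]) (use r c in \<open>auto simp: cell_def\<close>)
  have row_cells: "row_cells A i = cell ` {e. e < N \<and> r e = i}" for i
    by (auto simp: row_cells_def filled cell_def)
  have col_cells: "col_cells A j = cell ` {e. e < N \<and> c e = j}" for j
    by (auto simp: col_cells_def filled cell_def)
  \<comment> \<open>Rows and columns are treated at once: \<open>S\<close> is the index set of a
    line and \<open>l\<close> is \<open>h\<close> or \<open>k\<close>. The sum in the ring is the
    integer sum reduced modulo \<open>v\<close>.\<close>
  have card: "card (cell ` S) = l" and sum: "finsum R (entry A) (cell ` S) \<noteq> \<zero>\<^bsub>R\<^esub>"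
    if f: "alternating_enum f l S" and "S \<subseteq> {..<N}" and "l > 0" for f l S
  proof -
    have inj_S: "inj_on cell S" using inj_cell \<open>S \<subseteq> {..<N}\<close> by (rule inj_on_subset)
    then show "card (cell ` S) = l"
      using alternating_enum_card[OF f] by (simp add: card_image)
    have "finite S" using \<open>S \<subseteq> {..<N}\<close> finite_subset by blast
    have a_S: "entry A (cell e) = a e" if "e \<in> S" for e
      using entry that \<open>S \<subseteq> {..<N}\<close> by blast
    have "finsum R (entry A) (cell ` S) = finsum R (\<lambda>e. entry A (cell e)) S"
      using a_S inj_S by (intro finsum_reindex) (auto simp: a_def)
    also have "\<dots> = finsum R (\<lambda>e. ((- 1) ^ e * x e) mod int v) S"
      using a_S by (intro finsum_cong') (auto simp: a_def)
    also have "\<dots> = (\<Sum>e\<in>S. (- 1) ^ e * x e) mod int v"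
      using \<open>finite S\<close> by (rule sum_cong)
    also have "\<dots> \<noteq> 0"
      using alternating_enum_sum_not_dvd[OF f \<open>l > 0\<close> \<open>S \<subseteq> {..<N}\<close> mono pos less]
      by (simp add: mod_eq_0_iff_dvd)
    finally show "finsum R (entry A) (cell ` S) \<noteq> \<zero>\<^bsub>R\<^esub>" by (simp add: res_zero_eq)
  qed
  \<comment> \<open>An odd \<open>e\<close> merely swaps the two members of the pair.\<close>
  have pair: "{#a e, \<ominus>\<^bsub>R\<^esub> a e#} = {#x e, int v - x e#}" if "e < N" for e
  proof -
    have "x e mod int v = x e" using pos[OF that] less[OF that] by simp
    moreover have "(- x e) mod int v = int v - x e"
      using pos[OF that] less[OF that] by (subst zmod_zminus1_eq_if) simp
    ultimately show ?thesis
      by (cases "even e") (simp_all add: a_def res_neg_eq add_mset_commute)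
  qed
  have "pm_entries R A = (\<Sum>e<N. {#a e, \<ominus>\<^bsub>R\<^esub> a e#})"
    unfolding pm_entries_def filled using inj_cell entry by (simp add: sum.reindex)
  also have "\<dots> = mset_set ({0..<int v} - J)"
    unfolding pm[symmetric] using pair by (intro sum.cong) auto
  finally have pm_A: "pm_entries R A = mset_set ({0..<int v} - J)" .
  have carrier: "carrier R = {0..<int v}"
    by (auto simp: res_carrier_eq)
  have "is_nonzero_sum_Heffter_array t m n h k A"
    unfolding is_nonzero_sum_Heffter_array_def v_def[symmetric] R_def[symmetric] Let_def
  proof (intro conjI exI[of _ J] allI impI ballI)
    show "entry A z \<in> carrier R" if "z \<in> filled_cells A" for z
      using that entry by (auto simp: filled a_def)
    show "count (pm_entries R A) y = 1" if "y \<in> carrier R - J" for y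
      using that by (simp add: pm_A carrier)
    show "count (pm_entries R A) y = 0" if "y \<in> J" for y
      using that by (simp add: pm_A)
    show "card (row_cells A i) = h" "finsum R (entry A) (row_cells A i) \<noteq> \<zero>\<^bsub>R\<^esub>" if i: "i < m" for i
    proof -
      obtain f where "alternating_enum f h {e. e < N \<and> r e = i}" using rows[OF i] ..
      from card[OF this] sum[OF this] \<open>h > 0\<close>
      show "card (row_cells A i) = h" "finsum R (entry A) (row_cells A i) \<noteq> \<zero>\<^bsub>R\<^esub>"
        unfolding row_cells by auto
    qed
    show "card (col_cells A j) = k" "finsum R (entry A) (col_cells A j) \<noteq> \<zero>\<^bsub>R\<^esub>" if j: "j < n" for j
    proof -
      obtain f where "alternating_enum f k {e. e < N \<and> c e = j}" using cols[OF j] ..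
      from card[OF this] sum[OF this] \<open>k > 0\<close>
      show "card (col_cells A j) = k" "finsum R (entry A) (col_cells A j) \<noteq> \<zero>\<^bsub>R\<^esub>"
        unfolding col_cells by auto
    qed
  qed (use A J in auto)
  then show ?thesis ..
qed

end
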